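(* Let $X$ and $Y$ be Banach spaces. Assume that $X$ is uniformly smooth and that $Y$ has property $\beta$. Then the pair $(X,Y)$ has the Bishop-Phelps-Bollobás point property.
   Context: All spaces are over the same scalar field $\mathbb{K}$, which is $\mathbb{R}$ or $\mathbb{C}$. $S_X$ and $B_X$ are the unit sphere and closed unit ball of $X$, and $\mathcal{L}(X,Y)$ is the space of bounded linear operators from $X$ into $Y$. A Banach space $X$ is uniformly smooth if the limit $\lim_{t\to 0}\frac{\|z+tx\|-1}{t}$ exists uniformly for all $x\in B_X$ and $z\in S_X$. A Banach space $Y$ has property $\beta$ (with constant $0\le\rho<1$) if there are sets $\{y_i:i\in I\}\subset S_Y$ and $\{y_i^*:i\in I\}\subset S_{Y^*}$ such that (i) $y_i^*(y_i)=1$ for all $i\in I$; (ii) $|y_i^*(y_j)|\le\rho<1$ for all $i,j\in I$ with $i\neq j$; (iii) $\|y\|=\sup_{i\in I}|y_i^*(y)|$ for all $y\in Y$. A pair $(X,Y)$ of Banach spaces has the Bishop-Phelps-Bollobás point property (BPBpp) if for every $\varepsilon>0$ there exists $\eta(\varepsilon)>0$ such that whenever $T\in\mathcal{L}(X,Y)$ with $\|T\|=1$ and $x\in S_X$ satisfy $\|T(x)\|>1-\eta(\varepsilon)$, there exists $S\in\mathcal{L}(X,Y)$ with $\|S\|=1$ such that $\|S(x)\|=1$ and $\|S-T\|<\varepsilon$. *)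

theory Defs
  imports "HOL-Analysis.Analysis"
begin

text \<open>
  The scalar field \<open>K\<close> is a type that is, up to an isometric isomorphism of fields over the reals,
  either \<open>\<real>\<close> or the field of complex numbers. Both concrete types are instances.
\<close>

class real_or_complex = real_normed_field +
  assumes real_or_complex:
    "\<exists>\<phi> :: 'a \<Rightarrow> complex.
       (\<forall>a b. \<phi> (a + b) = \<phi> a + \<phi> b) \<and> (\<forall>a b. \<phi> (a * b) = \<phi> a * \<phi> b) \<and>
       (\<forall>r a. \<phi> (scaleR r a) = scaleR r (\<phi> a)) \<and> (\<forall>a. norm (\<phi> a) = norm a) \<and>
       (range \<phi> = \<real> \<or> range \<phi> = UNIV)"

instance real :: real_or_complex
  by standard (rule exI[of _ complex_of_real], auto simp: Reals_def scaleR_conv_of_real)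

instance complex :: real_or_complex
  by standard (rule exI[of _ "\<lambda>z. z"], auto)

text \<open>
  A Banach space over \<open>K\<close>: the class \<^class>\<open>banach\<close> provides the norm, completeness and the real
  structure, and \<open>scale\<close> is a multiplication by scalars from \<open>K\<close> that extends the real one.
\<close>

locale banach_over = vector_space scale
  for scale :: "'k::real_or_complex \<Rightarrow> 'a::banach \<Rightarrow> 'a" +
  assumes scale_of_real: "scale (of_real r) x = r *\<^sub>R x"
    and norm_scale: "norm (scale c x) = norm c * norm x"

lemma banach_over_scaleR: "banach_over (scaleR :: real \<Rightarrow> 'a::banach \<Rightarrow> 'a)"
  by unfold_locales (auto simp: algebra_simps)

lemma banach_over_complex: "banach_over ((*) :: complex \<Rightarrow> complex \<Rightarrow> complex)"
  by unfold_locales (auto simp: algebra_simps norm_mult scaleR_conv_of_real)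

text \<open>
  The space \<open>L(X,Y)\<close> of bounded \<open>K\<close>-linear operators, inside the type of bounded real-linear
  operators; the norm is that of the latter type, i.e. the operator norm.
\<close>

definition bounded_operators ::
    "('k::real_or_complex \<Rightarrow> 'a::banach \<Rightarrow> 'a) \<Rightarrow> ('k \<Rightarrow> 'b::real_normed_vector \<Rightarrow> 'b) \<Rightarrow> ('a \<Rightarrow>\<^sub>L 'b) set"
  where "bounded_operators sX sY = {T. Vector_Spaces.linear sX sY (blinfun_apply T)}"

definition dual_space ::
    "('k::real_or_complex \<Rightarrow> 'a::banach \<Rightarrow> 'a) \<Rightarrow> ('a \<Rightarrow>\<^sub>L 'k) set"
  where "dual_space sX = bounded_operators sX (*)"

text \<open>
  The limit is over real \<open>t \<noteq> 0\<close> tending to 0, also for complex spaces.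
\<close>

definition uniformly_smooth :: "'a::banach itself \<Rightarrow> bool"
  where "uniformly_smooth _ \<longleftrightarrow>
    (\<exists>l. uniform_limit (cball (0::'a) 1 \<times> sphere (0::'a) 1)
           (\<lambda>t (x, z). (norm (z + t *\<^sub>R x) - 1) / t) l (at (0::real)))"

text \<open>
  The supremum is taken in \<open>[0, \<infinity>]\<close>, so that it is 0 for an empty family (which is possible only
  if the space is trivial).
\<close>

definition property_beta_family ::
    "('k::real_or_complex \<Rightarrow> 'b::banach \<Rightarrow> 'b) \<Rightarrow> real \<Rightarrow> 'i set \<Rightarrow> ('i \<Rightarrow> 'b) \<Rightarrow> ('i \<Rightarrow> 'b \<Rightarrow>\<^sub>L 'k) \<Rightarrow> bool"
  where "property_beta_family sY \<rho> I y ys \<longleftrightarrow>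
    0 \<le> \<rho> \<and> \<rho> < 1 \<and>
    (\<forall>i\<in>I. norm (y i) = 1) \<and>
    (\<forall>i\<in>I. ys i \<in> dual_space sY \<and> norm (ys i) = 1) \<and>
    (\<forall>i\<in>I. blinfun_apply (ys i) (y i) = 1) \<and>
    (\<forall>i\<in>I. \<forall>j\<in>I. i \<noteq> j \<longrightarrow> norm (blinfun_apply (ys i) (y j)) \<le> \<rho>) \<and>
    (\<forall>v. ennreal (norm v) = (SUP i\<in>I. ennreal (norm (blinfun_apply (ys i) v))))"

text \<open>
  The index set may be taken inside the space itself, because the map from indices \<open>i\<close> to vectors
  \<open>y i\<close> is injective; the lemma below covers families over an arbitrary index type.
\<close>

definition property_beta :: "('k::real_or_complex \<Rightarrow> 'b::banach \<Rightarrow> 'b) \<Rightarrow> bool"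
  where "property_beta sY \<longleftrightarrow>
    (\<exists>\<rho> (I :: 'b set) y ys. property_beta_family sY \<rho> I y ys)"

lemma property_betaI:
  fixes I :: "'i set"
  assumes "property_beta_family sY \<rho> I y ys"
  shows "property_beta sY"
proof -
  have inj: "inj_on y I"
  proof (rule inj_onI, rule ccontr)
    fix i j assume ij: "i \<in> I" "j \<in> I" "y i = y j" "i \<noteq> j"
    then have "norm (blinfun_apply (ys i) (y j)) \<le> \<rho>" "blinfun_apply (ys i) (y i) = 1" "\<rho> < 1"
      using assms unfolding property_beta_family_def by blast+
    with ij show False by simp
  qed
  define g where "g = the_inv_into I y"
  have g: "g (y i) = i" if "i \<in> I" for i
    using that inj by (simp add: g_def the_inv_into_f_f)
  have sup: "(SUP v\<in>y ` I. ennreal (norm (blinfun_apply (ys (g v)) w))) =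
      (SUP i\<in>I. ennreal (norm (blinfun_apply (ys i) w)))" for w
    unfolding image_image by (rule SUP_cong) (simp_all add: g)
  have "property_beta_family sY \<rho> (y ` I) (\<lambda>v. v) (\<lambda>v. ys (g v))"
    using assms unfolding property_beta_family_def sup
    by (auto simp: g)
  then show ?thesis
    unfolding property_beta_def by blast
qed

definition BPBpp ::
    "('k::real_or_complex \<Rightarrow> 'a::banach \<Rightarrow> 'a) \<Rightarrow> ('k \<Rightarrow> 'b::banach \<Rightarrow> 'b) \<Rightarrow> bool"
  where "BPBpp sX sY \<longleftrightarrow>
    (\<forall>\<epsilon>>0. \<exists>\<eta>>0. \<forall>T\<in>bounded_operators sX sY. \<forall>x.
       norm T = 1 \<longrightarrow> norm x = 1 \<longrightarrow> norm (blinfun_apply T x) > 1 - \<eta> \<longrightarrow>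
       (\<exists>S\<in>bounded_operators sX sY.
          norm S = 1 \<and> norm (blinfun_apply S x) = 1 \<and> norm (S - T) < \<epsilon>))"

end

theory Submission
  imports Defs
begin

text \<open>
  For functionals the idea is that of Smulian's test. If \<open>x\<close> is a unit vector of a uniformly smooth
  space, the directional derivative of the norm at \<open>x\<close> is a real-linear functional of norm 1 that
  takes the value 1 at \<open>x\<close> (\<open>norm_derivative_supports\<close>), and it extends to a \<open>K\<close>-linear functional
  \<open>g\<close> with the same properties (\<open>functional_with_real_part\<close>). If \<open>f\<close> is any functional in the dual unit
  ball with \<open>Re f(x) > 1 - \<eta>\<close>, then adding \<open>Re f(x + t h) \<le> \<parallel>x + t h\<parallel>\<close> and
  \<open>Re g(x - t h) \<le> \<parallel>x - t h\<parallel>\<close> gives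
  \<open>t Re (f - g)(h) \<le> \<parallel>x + t h\<parallel> + \<parallel>x - t h\<parallel> - 2 + \<eta>\<close>,
  and by uniform smoothness the right-hand side is at most \<open>\<delta> t\<close> for a suitable \<open>t\<close> and a small \<open>\<eta>\<close>,
  both independent of \<open>x\<close>, \<open>h\<close> and \<open>f\<close>. Hence \<open>f\<close> is close to a functional that attains its norm
  at the point \<open>x\<close> itself (\<open>nearly_norming_functional_approximation\<close>).

  For operators, choose \<open>i\<close> such that the functional \<open>f = y\<^sub>i\<^sup>* \<circ> T\<close> is nearly norming at \<open>x\<close>, replace it by
  \<open>g\<close> as above, and change \<open>T\<close> only in the direction \<open>y\<^sub>i\<close>: the operator
  \<open>h \<mapsto> T h + ((1 + c) g(h) - f(h)) y\<^sub>i\<close> is sent to \<open>(1 + c) g\<close> by \<open>y\<^sub>i\<^sup>*\<close>, while every other \<open>y\<^sub>j\<^sup>*\<close> sees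
  the change damped by the factor \<open>\<rho> < 1\<close>. For \<open>c\<close> proportional to \<open>\<parallel>g - f\<parallel>\<close> the coordinate \<open>i\<close>
  therefore dominates, so that this operator has norm \<open>1 + c\<close>, attained at \<open>x\<close>.
\<close>

section \<open>The derivative of the norm\<close>

text \<open>
  Limits of the two-sided quotient are homogeneous for all real factors, negative ones included;
  this is what makes the derivative linear and not merely sublinear.
\<close>

lemma norm_quotient_tendsto_scaleR:
  fixes x h :: "'a::real_normed_vector"
  assumes x: "norm x = 1"
    and lim: "((\<lambda>t. (norm (x + t *\<^sub>R h) - 1) / t) \<longlongrightarrow> d) (at 0)"
  shows "((\<lambda>t. (norm (x + t *\<^sub>R (r *\<^sub>R h)) - 1) / t) \<longlongrightarrow> r * d) (at 0)"
proof (cases "r = 0")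
  case True
  then show ?thesis using x by simp
next
  case False
  have "filterlim (\<lambda>t. t * r) (nhds 0) (at 0)"
    by (rule tendsto_eq_intros refl | simp)+
  then have "filterlim (\<lambda>t. t * r) (at 0) (at (0::real))"
    using False by (auto simp: filterlim_at eventually_at_filter)
  from filterlim_compose[OF lim this]
  have "((\<lambda>t. r * ((norm (x + (t * r) *\<^sub>R h) - 1) / (t * r))) \<longlongrightarrow> r * d) (at 0)"
    by (intro tendsto_intros)
  moreover have "r * ((norm (x + (t * r) *\<^sub>R h) - 1) / (t * r))
      = (norm (x + t *\<^sub>R (r *\<^sub>R h)) - 1) / t" for t
    using False by simp
  ultimately show ?thesis by simp
qed

text \<open>
  By convexity of the norm the derivative is subadditive; together with homogeneity for negative
  factors this yields additivity.
\<close>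

lemma norm_derivative_supports:
  fixes x :: "'a::real_normed_vector"
  assumes x: "norm x = 1"
    and ex: "\<And>h. norm h \<le> 1 \<Longrightarrow> \<exists>d. ((\<lambda>t. (norm (x + t *\<^sub>R h) - 1) / t) \<longlongrightarrow> d) (at 0)"
  obtains l :: "'a \<Rightarrow> real" where "linear l" "l x = 1" "\<And>h. l h \<le> norm h"
proof -
  have ex_all: "\<exists>d. ((\<lambda>t. (norm (x + t *\<^sub>R h) - 1) / t) \<longlongrightarrow> d) (at 0)" for h
  proof (cases "h = 0")
    case False
    then have "norm (h /\<^sub>R norm h) \<le> 1" by simp
    from ex[OF this] obtain d
      where "((\<lambda>t. (norm (x + t *\<^sub>R (h /\<^sub>R norm h)) - 1) / t) \<longlongrightarrow> d) (at 0)" ..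
    from norm_quotient_tendsto_scaleR[OF x this, of "norm h"] False show ?thesis by auto
  next
    case True
    with ex[of h] show ?thesis by simp
  qed
  define l where "l h = (THE d. ((\<lambda>t. (norm (x + t *\<^sub>R h) - 1) / t) \<longlongrightarrow> d) (at 0))" for h
  have l_eq: "l h = d" if "((\<lambda>t. (norm (x + t *\<^sub>R h) - 1) / t) \<longlongrightarrow> d) (at 0)" for h d
    unfolding l_def using that tendsto_unique[OF trivial_limit_at] by blast
  have l_lim: "((\<lambda>t. (norm (x + t *\<^sub>R h) - 1) / t) \<longlongrightarrow> l h) (at 0)" for h
    using ex_all[of h] l_eq by blast
  have l_scaleR: "l (r *\<^sub>R h) = r * l h" for r h
    by (rule l_eq[OF norm_quotient_tendsto_scaleR[OF x l_lim]])
  have l_right: "((\<lambda>t. (norm (x + t *\<^sub>R h) - 1) / t) \<longlongrightarrow> l h) (at_right 0)" for h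
    using l_lim by (rule filterlim_mono) (auto simp: at_le)
  have l_subadd: "l (h + k) \<le> l h + l k" for h k
  proof -
    \<comment> \<open>\<open>x + t (h + k)\<close> is the midpoint of \<open>x + 2 t h\<close> and \<open>x + 2 t k\<close>.\<close>
    have "((\<lambda>t. ((norm (x + t *\<^sub>R (2 *\<^sub>R h)) - 1) / t + (norm (x + t *\<^sub>R (2 *\<^sub>R k)) - 1) / t) / 2)
        \<longlongrightarrow> (l (2 *\<^sub>R h) + l (2 *\<^sub>R k)) / 2) (at_right 0)"
      by (intro tendsto_intros l_right) simp
    moreover have "(l (2 *\<^sub>R h) + l (2 *\<^sub>R k)) / 2 = l h + l k"
      by (simp add: l_scaleR)
    ultimately have lim: "((\<lambda>t. ((norm (x + t *\<^sub>R (2 *\<^sub>R h)) - 1) / t + (norm (x + t *\<^sub>R (2 *\<^sub>R k)) - 1) / t) / 2)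
        \<longlongrightarrow> l h + l k) (at_right 0)"
      by simp
    have "(norm (x + t *\<^sub>R (h + k)) - 1) / t
        \<le> ((norm (x + t *\<^sub>R (2 *\<^sub>R h)) - 1) / t + (norm (x + t *\<^sub>R (2 *\<^sub>R k)) - 1) / t) / 2"
      if "t > 0" for t
    proof -
      have "2 * norm (x + t *\<^sub>R (h + k)) = norm (2 *\<^sub>R (x + t *\<^sub>R (h + k)))" by simp
      also have "2 *\<^sub>R (x + t *\<^sub>R (h + k)) = (x + t *\<^sub>R (2 *\<^sub>R h)) + (x + t *\<^sub>R (2 *\<^sub>R k))"
        by (simp add: scaleR_2[of x] scaleR_add_right ac_simps)
      also have "norm \<dots> \<le> norm (x + t *\<^sub>R (2 *\<^sub>R h)) + norm (x + t *\<^sub>R (2 *\<^sub>R k))"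
        by (rule norm_triangle_ineq)
      finally have "norm (x + t *\<^sub>R (h + k)) - 1
          \<le> ((norm (x + t *\<^sub>R (2 *\<^sub>R h)) - 1) + (norm (x + t *\<^sub>R (2 *\<^sub>R k)) - 1)) / 2"
        by simp
      then have "(norm (x + t *\<^sub>R (h + k)) - 1) / t
          \<le> ((norm (x + t *\<^sub>R (2 *\<^sub>R h)) - 1) + (norm (x + t *\<^sub>R (2 *\<^sub>R k)) - 1)) / 2 / t"
        using that by (intro divide_right_mono) auto
      then show ?thesis by (simp add: add_divide_distrib diff_divide_distrib mult.commute)
    qed
    then show ?thesis
      by (intro tendsto_le[OF _ lim l_right]) (auto simp: eventually_at_right_less intro: eventually_at_rightI[of 0 1])
  qed
  have l_minus: "l (- h) = - l h" for h
    using l_scaleR[of "-1" h] by simp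
  have "linear l"
  proof (rule linearI)
    fix h k
    have "l (- h + - k) \<le> l (- h) + l (- k)" by (rule l_subadd)
    moreover have "l (- h + - k) = - l (h + k)" using l_minus[of "h + k"] by simp
    ultimately show "l (h + k) = l h + l k"
      using l_subadd[of h k] by (simp add: l_minus)
  qed (simp add: l_scaleR)
  moreover have "l x = 1"
  proof (rule l_eq, rule tendsto_eventually)
    have "(norm (x + t *\<^sub>R x) - 1) / t = 1" if "t \<noteq> 0" "\<bar>t\<bar> < 1" for t
    proof -
      have "x + t *\<^sub>R x = (1 + t) *\<^sub>R x" by (simp add: algebra_simps)
      then have "norm (x + t *\<^sub>R x) = 1 + t" using x that by simp
      then show ?thesis using that by simp
    qed
    then show "\<forall>\<^sub>F t in at 0. (norm (x + t *\<^sub>R x) - 1) / t = 1"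
      unfolding eventually_at by (intro exI[of _ 1]) auto
  qed
  moreover have "l h \<le> norm h" for h
  proof (rule tendsto_upperbound[OF l_right])
    have "(norm (x + t *\<^sub>R h) - 1) / t \<le> norm h" if "t > 0" for t
      using norm_triangle_ineq[of x "t *\<^sub>R h"] that x by (simp add: field_simps)
    then show "\<forall>\<^sub>F t in at_right 0. (norm (x + t *\<^sub>R h) - 1) / t \<le> norm h"
      by (auto intro: eventually_at_rightI[of 0 1])
  qed simp
  ultimately show ?thesis using that by blast
qed

lemma uniformly_smooth_support:
  fixes x :: "'a::banach"
  assumes "uniformly_smooth TYPE('a)" and x: "norm x = 1"
  obtains l :: "'a \<Rightarrow> real" where "linear l" "l x = 1" "\<And>h. l h \<le> norm h"
proof -
  from assms obtain d where "uniform_limit (cball (0::'a) 1 \<times> sphere (0::'a) 1)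
           (\<lambda>t (x, z). (norm (z + t *\<^sub>R x) - 1) / t) d (at (0::real))"
    unfolding uniformly_smooth_def by blast
  from tendsto_uniform_limitI[OF this]
  have "((\<lambda>t. (norm (x + t *\<^sub>R h) - 1) / t) \<longlongrightarrow> d (h, x)) (at 0)" if "norm h \<le> 1" for h
    using x that by (force simp: dist_norm)
  then show ?thesis
    using norm_derivative_supports[OF x] that by blast
qed

text \<open>
  The quotients at \<open>t\<close> and \<open>- t\<close> approach the same limit, hence their difference, which is the
  second difference of the norm divided by \<open>t\<close>, is uniformly small.
\<close>

lemma uniformly_smooth_second_difference:
  assumes "uniformly_smooth TYPE('a::banach)" and "\<delta> > 0"
  obtains t where "t > 0"
    "\<And>x h :: 'a. norm x = 1 \<Longrightarrow> norm h \<le> 1 \<Longrightarrow> norm (x + t *\<^sub>R h) + norm (x - t *\<^sub>R h) - 2 \<le> \<delta> * t"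
proof -
  from assms obtain d where "uniform_limit (cball (0::'a) 1 \<times> sphere (0::'a) 1)
           (\<lambda>t (x, z). (norm (z + t *\<^sub>R x) - 1) / t) d (at (0::real))"
    unfolding uniformly_smooth_def by blast
  then have "\<forall>\<^sub>F t in at 0. \<forall>p\<in>cball (0::'a) 1 \<times> sphere (0::'a) 1.
      dist (case p of (x, z) \<Rightarrow> (norm (z + t *\<^sub>R x) - 1) / t) (d p) < \<delta> / 2"
    using \<open>\<delta> > 0\<close> by (auto dest: uniform_limitD[where e = "\<delta> / 2"])
  then obtain s where s: "s > 0" and near: "\<And>t p. t \<noteq> 0 \<Longrightarrow> dist t 0 < s \<Longrightarrow>
      p \<in> cball (0::'a) 1 \<times> sphere (0::'a) 1 \<Longrightarrow>
      dist (case p of (x, z) \<Rightarrow> (norm (z + t *\<^sub>R x) - 1) / t) (d p) < \<delta> / 2"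
    unfolding eventually_at by blast
  define t where "t = s / 2"
  with s have t: "t > 0" "t < s" by simp_all
  have "norm (x + t *\<^sub>R h) + norm (x - t *\<^sub>R h) - 2 \<le> \<delta> * t"
    if "norm x = 1" "norm h \<le> 1" for x h :: 'a
  proof -
    have triangle: "a + b \<le> \<delta>" if "\<bar>a - c\<bar> < \<delta> / 2" "\<bar>- b - c\<bar> < \<delta> / 2" for a b c :: real
      using that by linarith
    have p: "(h, x) \<in> cball (0::'a) 1 \<times> sphere (0::'a) 1" using that by simp
    have "\<bar>(norm (x + t *\<^sub>R h) - 1) / t - d (h, x)\<bar> < \<delta> / 2"
      using near[OF _ _ p, of t] t by (simp add: dist_real_def)
    moreover have "\<bar>- ((norm (x - t *\<^sub>R h) - 1) / t) - d (h, x)\<bar> < \<delta> / 2"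
      using near[OF _ _ p, of "- t"] t by (simp add: dist_real_def)
    ultimately have "(norm (x + t *\<^sub>R h) - 1) / t + (norm (x - t *\<^sub>R h) - 1) / t \<le> \<delta>"
      by (rule triangle)
    then have "(norm (x + t *\<^sub>R h) + norm (x - t *\<^sub>R h) - 2) / t \<le> \<delta>"
      by (simp flip: add_divide_distrib)
    then show ?thesis using t by (simp add: pos_divide_le_eq)
  qed
  with that[of t] t show ?thesis by simp
qed

section \<open>Functionals over the real or complex scalars\<close>

text \<open>
  Real part and imaginary unit of the abstract scalar field. Taking \<open>j = 0\<close> in the real case lets
  the formula \<open>l(h) - j l(j h)\<close> for a functional with real part \<open>l\<close> serve for both scalar fields.
\<close>

lemma real_or_complex_real_part:
  obtains re :: "'k::real_or_complex \<Rightarrow> real" and j :: 'k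
  where "linear re" "\<And>a. \<bar>re a\<bar> \<le> norm a" "re 1 = 1" "re j = 0"
    "j = 0 \<or> j * j = - 1" "\<And>k. \<exists>a b. k = of_real a + of_real b * j"
proof -
  obtain \<phi> :: "'k \<Rightarrow> complex" where
    add: "\<And>a b. \<phi> (a + b) = \<phi> a + \<phi> b" and mult: "\<And>a b. \<phi> (a * b) = \<phi> a * \<phi> b" and
    scale: "\<And>r a. \<phi> (r *\<^sub>R a) = r *\<^sub>R \<phi> a" and norm: "\<And>a. norm (\<phi> a) = norm a" and
    range: "range \<phi> = \<real> \<or> range \<phi> = UNIV"
    using real_or_complex by metis
  have lin: "linear \<phi>" by (rule linearI) (auto simp: add scale)
  have inj: "a = b" if "\<phi> a = \<phi> b" for a b
    using that norm[of "a - b"] linear_diff[OF lin, of a b] by simp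
  have one: "\<phi> 1 = 1"
    using mult[of 1 1] norm[of 1] by auto
  have of_real: "\<phi> (of_real r) = of_real r" for r
    using scale[of r 1] by (simp add: one of_real_def)
  have re: "linear (\<lambda>a. Re (\<phi> a))" "\<And>a. \<bar>Re (\<phi> a)\<bar> \<le> norm a" "Re (\<phi> 1) = 1"
    using abs_Re_le_cmod norm by (auto intro!: linearI simp: add scale one) metis
  from range show ?thesis
  proof
    assume R: "range \<phi> = \<real>"
    have "k = of_real (Re (\<phi> k)) + of_real 0 * 0" for k
    proof (rule inj)
      have "\<phi> k \<in> \<real>" using R by blast
      then show "\<phi> k = \<phi> (of_real (Re (\<phi> k)) + of_real 0 * 0)"
        by (auto simp: of_real elim: Reals_cases)
    qed
    then show ?thesis
      by (intro that[of "\<lambda>a. Re (\<phi> a)" 0] re) (use linear_0[OF lin] in \<open>simp_all, blast\<close>)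
  next
    assume "range \<phi> = UNIV"
    then obtain j where j: "\<phi> j = \<i>" by (metis surjD)
    have "j * j = - 1"
      by (intro inj) (simp add: mult j linear_neg[OF lin] one)
    moreover have "k = of_real (Re (\<phi> k)) + of_real (Im (\<phi> k)) * j" for k
      by (intro inj) (simp add: add mult of_real j complex_eq mult.commute)
    ultimately show ?thesis
      by (intro that[of "\<lambda>a. Re (\<phi> a)" j] re) (simp_all add: j, blast)
  qed
qed

lemma rotation_to_norm:
  fixes a :: "'k::real_normed_field"
  obtains u where "norm u = 1" "u * a = of_real (norm a)"
proof (cases "a = 0")
  case True
  with that[of 1] show ?thesis by simp
next
  case False
  with that[of "of_real (norm a) / a"] show ?thesis by (simp add: norm_divide)
qed

lemma bounded_operators_iff:
  assumes "vector_space sX" and "vector_space sY"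
  shows "T \<in> bounded_operators sX sY \<longleftrightarrow> (\<forall>c h. blinfun_apply T (sX c h) = sY c (blinfun_apply T h))"
  using assms
  by (auto simp: bounded_operators_def Vector_Spaces.linear_iff blinfun.add_right)

lemma dual_space_iff:
  fixes sX :: "'k::real_or_complex \<Rightarrow> 'a::banach \<Rightarrow> 'a"
  assumes "vector_space sX"
  shows "f \<in> dual_space sX \<longleftrightarrow> (\<forall>c h. blinfun_apply f (sX c h) = c * blinfun_apply f h)"
proof -
  have "vector_space ((*) :: 'k \<Rightarrow> 'k \<Rightarrow> 'k)"
    by unfold_locales (auto simp: algebra_simps)
  then show ?thesis
    unfolding dual_space_def by (rule bounded_operators_iff[OF assms])
qed

text \<open>
  A functional is as large as the real part of its values, because its value at \<open>h\<close> becomes real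
  and nonnegative when \<open>h\<close> is multiplied by a suitable scalar of modulus 1.
\<close>

lemma dual_space_norm_le_real_part:
  fixes sX :: "'k::real_or_complex \<Rightarrow> 'a::banach \<Rightarrow> 'a" and re :: "'k \<Rightarrow> real"
  assumes "banach_over sX" and f: "f \<in> dual_space sX"
    and re: "linear re" "re 1 = 1"
    and "b \<ge> 0" and bound: "\<And>h. norm h = 1 \<Longrightarrow> re (blinfun_apply f h) \<le> b"
  shows "norm f \<le> b"
proof (rule norm_blinfun_bound)
  interpret X: banach_over sX by fact
  have f_scale: "blinfun_apply f (sX c h) = c * blinfun_apply f h" for c h
    using f dual_space_iff[OF X.vector_space_axioms] by blast
  have re_of_real: "re (of_real r) = r" for r
    using linear_scale[OF re(1), of r 1] re(2) by (simp add: of_real_def)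
  have unit: "norm (blinfun_apply f h) \<le> b" if h: "norm h = 1" for h
  proof -
    obtain u where u: "norm u = 1" "u * blinfun_apply f h = of_real (norm (blinfun_apply f h))"
      by (rule rotation_to_norm)
    have "norm (sX u h) = 1" using h u by (simp add: X.norm_scale)
    from bound[OF this] show ?thesis by (simp add: f_scale u re_of_real)
  qed
  show "norm (blinfun_apply f h) \<le> b * norm h" for h
  proof (cases "h = 0")
    case False
    then have "norm (blinfun_apply f (h /\<^sub>R norm h)) \<le> b" by (intro unit) simp
    with False show ?thesis by (simp add: blinfun.scaleR_right field_simps)
  qed simp
qed fact

text \<open>
  The classical passage from real-linear to complex-linear functionals, \<open>g(h) = l(h) - i l(i h)\<close>.
\<close>

lemma functional_with_real_part:
  fixes sX :: "'k::real_or_complex \<Rightarrow> 'a::banach \<Rightarrow> 'a" and re :: "'k \<Rightarrow> real" and j :: 'k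
  assumes "banach_over sX"
    and re: "linear re" "re 1 = 1" "re j = 0"
    and j: "j = 0 \<or> j * j = - 1" and decomp: "\<And>k. \<exists>a b. k = of_real a + of_real b * j"
    and l: "linear l" "\<And>h. l h \<le> norm h"
  obtains g where "g \<in> dual_space sX" "norm g \<le> 1" "\<And>h. re (blinfun_apply g h) = l h"
proof -
  interpret X: banach_over sX by fact
  define G where "G h = of_real (l h) - of_real (l (sX j h)) * j" for h
  have sX_scaleR: "sX c (r *\<^sub>R h) = r *\<^sub>R sX c h" for c r h
    by (metis X.scale_left_commute X.scale_of_real)
  have G_linear: "linear G"
    by (rule linearI)
      (simp_all add: G_def X.scale_right_distrib sX_scaleR linear_add[OF l(1)] linear_scale[OF l(1)]
        algebra_simps scaleR_conv_of_real)
  have G_j: "G (sX j h) = j * G h" for h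
    using j
  proof
    assume jj: "j * j = - 1"
    then have "G (sX j h) = of_real (l (sX j h)) + j * of_real (l h)"
      by (simp add: G_def linear_neg[OF l(1)] X.scale_minus_left mult.commute)
    moreover have "j * (a * j) = - a" for a
      by (simp add: mult.left_commute[of j] jj)
    ultimately show ?thesis
      by (simp add: G_def right_diff_distrib)
  qed (simp add: G_def linear_0[OF l(1)])
  have G_scale: "G (sX c h) = c * G h" for c h
  proof -
    obtain a b where c: "c = of_real a + of_real b * j" using decomp by blast
    have "sX c h = a *\<^sub>R h + b *\<^sub>R sX j h"
      by (simp add: c X.scale_left_distrib X.scale_of_real flip: X.scale_scale)
    then show ?thesis
      by (simp add: c linear_add[OF G_linear] linear_scale[OF G_linear] G_j
          scaleR_conv_of_real algebra_simps)
  qed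
  have re_G: "re (G h) = l h" for h
    using linear_scale[OF re(1), of _ 1] linear_scale[OF re(1), of _ j]
    by (simp add: G_def linear_diff[OF re(1)] re of_real_def)
  have abs_l: "\<bar>l h\<bar> \<le> norm h" for h
    using l(2)[of h] l(2)[of "- h"] linear_neg[OF l(1), of h] by simp
  have "bounded_linear G"
  proof (rule bounded_linear_intro[where K = "1 + norm j * norm j"])
    fix h
    have "norm (G h) \<le> \<bar>l h\<bar> + \<bar>l (sX j h)\<bar> * norm j"
      unfolding G_def by (rule order_trans[OF norm_triangle_ineq4]) (simp add: norm_mult)
    also have "\<dots> \<le> norm h + norm (sX j h) * norm j"
      by (intro add_mono mult_right_mono abs_l) simp
    finally show "norm (G h) \<le> norm h * (1 + norm j * norm j)"
      by (simp add: X.norm_scale algebra_simps)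
  qed (simp_all add: linear_add[OF G_linear] linear_scale[OF G_linear])
  then have apply_g: "blinfun_apply (Blinfun G) = G" by (rule bounded_linear_Blinfun_apply)
  have dual: "Blinfun G \<in> dual_space sX"
    by (simp add: dual_space_iff[OF X.vector_space_axioms] apply_g G_scale)
  have "norm (Blinfun G) \<le> 1"
  proof (rule dual_space_norm_le_real_part[OF assms(1) dual re(1,2)])
    show "re (blinfun_apply (Blinfun G) h) \<le> 1" if "norm h = 1" for h
      using l(2)[of h] that by (simp add: apply_g re_G)
  qed simp
  with dual show ?thesis using that by (simp add: apply_g re_G)
qed

section \<open>The property for functionals and for operators\<close>

text \<open>
  The Bishop-Phelps-Bollobas point property of the pair \<open>(X, K)\<close>. The functionals \<open>f\<close>
  range over the whole dual ball because \<open>y\<^sub>i\<^sup>* \<circ> T\<close> can have norm less than 1.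
  The support functional of \<open>x\<close> itself serves, up to a scalar factor of modulus 1, for all
  functionals \<open>f\<close>.
\<close>

lemma nearly_norming_functional_approximation:
  fixes sX :: "'k::real_or_complex \<Rightarrow> 'a::banach \<Rightarrow> 'a"
  assumes "banach_over sX" and smooth: "uniformly_smooth TYPE('a)" and "\<delta> > 0"
  obtains \<eta> where "\<eta> > 0"
    "\<And>f x. f \<in> dual_space sX \<Longrightarrow> norm f \<le> 1 \<Longrightarrow> norm x = 1 \<Longrightarrow> norm (blinfun_apply f x) > 1 - \<eta> \<Longrightarrow>
      \<exists>g\<in>dual_space sX. norm g \<le> 1 \<and> norm (blinfun_apply g x) = 1 \<and> norm (g - f) \<le> \<delta>"
proof -
  interpret X: banach_over sX by fact
  note dual_iff = dual_space_iff[OF X.vector_space_axioms]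
  obtain re :: "'k \<Rightarrow> real" and j :: 'k where
    re: "linear re" "\<And>a. \<bar>re a\<bar> \<le> norm a" "re 1 = 1" "re j = 0" and
    j: "j = 0 \<or> j * j = - 1" "\<And>k. \<exists>a b. k = of_real a + of_real b * j"
    by (rule real_or_complex_real_part) blast
  obtain t where t: "t > 0" and second: "\<And>x h :: 'a. norm x = 1 \<Longrightarrow> norm h \<le> 1 \<Longrightarrow>
      norm (x + t *\<^sub>R h) + norm (x - t *\<^sub>R h) - 2 \<le> \<delta> / 2 * t"
    using uniformly_smooth_second_difference[OF smooth, of "\<delta> / 2"] \<open>\<delta> > 0\<close> by auto
  have "\<exists>g\<in>dual_space sX. norm g \<le> 1 \<and> norm (blinfun_apply g x) = 1 \<and> norm (g - f) \<le> \<delta>"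
    if f: "f \<in> dual_space sX" "norm f \<le> 1" and x: "norm x = 1"
      and fx: "norm (blinfun_apply f x) > 1 - \<delta> / 2 * t" for f x
  proof -
    obtain l :: "'a \<Rightarrow> real" where l: "linear l" "l x = 1" "\<And>h. l h \<le> norm h"
      by (rule uniformly_smooth_support[OF smooth x]) blast
    obtain g where g: "g \<in> dual_space sX" "norm g \<le> 1" and re_g: "\<And>h. re (blinfun_apply g h) = l h"
      by (rule functional_with_real_part[OF assms(1) re(1,3,4) j l(1,3)]) blast
    obtain u where u: "norm u = 1" "u * blinfun_apply f x = of_real (norm (blinfun_apply f x))"
      by (rule rotation_to_norm)
    have "u \<noteq> 0" using u(1) by auto
    have re_fx: "re (u * blinfun_apply f x) = norm (blinfun_apply f x)"
      using linear_scale[OF re(1), of _ 1] by (simp add: u re of_real_def)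
    have g_eq: "blinfun_apply g (sX c h) = c * blinfun_apply g h" for c h
      using g dual_iff by blast
    have f_eq: "blinfun_apply f (sX c h) = c * blinfun_apply f h" for c h
      using f dual_iff by blast
    define v where "v = inverse u"
    have v: "norm v = 1" using u by (simp add: v_def norm_inverse)
    have uv: "u * (v * a) = a" for a using \<open>u \<noteq> 0\<close> by (simp add: v_def)
    have bl: "bounded_linear (\<lambda>h. v * blinfun_apply g h)"
      by (intro bounded_linear_mult_right bounded_linear_compose[OF bounded_linear_mult_right] blinfun.bounded_linear_right)
    define g' where "g' = Blinfun (\<lambda>h. v * blinfun_apply g h)"
    have g': "blinfun_apply g' h = v * blinfun_apply g h" for h
      by (simp add: g'_def bounded_linear_Blinfun_apply[OF bl])
    have dual_g': "g' \<in> dual_space sX" by (simp add: dual_iff g' g_eq mult_ac)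
    have norm_g': "norm g' \<le> 1"
    proof (rule norm_blinfun_bound)
      show "norm (blinfun_apply g' h) \<le> 1 * norm h" for h
        using norm_blinfun[of g h] mult_right_mono[OF g(2), of "norm h"] by (simp add: g' norm_mult v)
    qed simp
    have "norm (blinfun_apply g' x) = 1"
    proof (rule antisym)
      show "norm (blinfun_apply g' x) \<le> 1" using norm_blinfun[of g' x] norm_g' x by simp
      show "1 \<le> norm (blinfun_apply g' x)"
        using re(2)[of "blinfun_apply g x"] re_g[of x] l(2) by (simp add: g' norm_mult v)
    qed
    moreover have "norm (g' - f) \<le> \<delta>"
    proof -
      \<comment> \<open>The real part is estimated for \<open>u (f - g')\<close>, because \<open>u f\<close> is the multiple of \<open>f\<close> whose
        real part at \<open>x\<close> is close to 1.\<close>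
      have bl2: "bounded_linear (\<lambda>h. u * blinfun_apply (f - g') h)"
        by (intro bounded_linear_compose[OF bounded_linear_mult_right] blinfun.bounded_linear_right)
      define d where "d = Blinfun (\<lambda>h. u * blinfun_apply (f - g') h)"
      have d_apply: "blinfun_apply d h = u * blinfun_apply (f - g') h" for h
        by (simp only: d_def bounded_linear_Blinfun_apply[OF bl2])
      have d: "blinfun_apply d h = u * blinfun_apply f h - blinfun_apply g h" for h
        by (simp add: d_apply blinfun.diff_left g' right_diff_distrib uv)
      have "norm d \<le> \<delta>"
      proof (rule dual_space_norm_le_real_part[OF assms(1) _ re(1,3)])
        show "d \<in> dual_space sX" by (simp add: dual_iff d f_eq g_eq algebra_simps)
        fix h :: 'a assume h: "norm h = 1"
        have re_uf: "re (u * blinfun_apply f k) \<le> norm k" for k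
          using re(2)[of "u * blinfun_apply f k"] norm_blinfun[of f k] mult_right_mono[OF f(2), of "norm k"]
          by (simp add: norm_mult u)
        have "norm (blinfun_apply f x) + t * re (u * blinfun_apply f h) = re (u * blinfun_apply f (x + t *\<^sub>R h))"
          using linear_add[OF re(1)] linear_scale[OF re(1)] re_fx
          by (simp add: blinfun.add_right blinfun.scaleR_right distrib_left)
        also have "\<dots> \<le> norm (x + t *\<^sub>R h)" by (rule re_uf)
        finally have "norm (blinfun_apply f x) + t * re (u * blinfun_apply f h) \<le> norm (x + t *\<^sub>R h)" .
        moreover have "1 - t * l h \<le> norm (x - t *\<^sub>R h)"
          using l(3)[of "x - t *\<^sub>R h"] by (simp add: linear_diff[OF l(1)] linear_scale[OF l(1)] l(2))
        ultimately have "t * (re (u * blinfun_apply f h) - l h) \<le> t * \<delta>"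
          using second[OF x, of h] h fx by (simp add: algebra_simps)
        then show "re (blinfun_apply d h) \<le> \<delta>"
          using t by (simp add: d linear_diff[OF re(1)] re_g)
      qed (use \<open>\<delta> > 0\<close> in simp)
      moreover have "norm (g' - f) \<le> norm d"
      proof (rule norm_blinfun_bound)
        show "norm (blinfun_apply (g' - f) h) \<le> norm d * norm h" for h
          using norm_blinfun[of d h] u
          by (simp add: d_apply norm_mult blinfun.diff_left norm_minus_commute)
      qed simp
      ultimately show ?thesis by simp
    qed
    ultimately show ?thesis using dual_g' norm_g' by blast
  qed
  with that[of "\<delta> / 2 * t"] \<open>\<delta> > 0\<close> t show ?thesis by simp
qed

text \<open>
  A change of \<open>T\<close> in the direction \<open>y\<^sub>i\<close> that makes \<open>y\<^sub>i\<^sup>*\<close> the dominating coordinate. The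
  coordinates other than \<open>i\<close> have norm at most \<open>1 + \<rho> (c + \<delta>)\<close>, which does not exceed \<open>1 + c\<close>
  because \<open>\<rho> \<delta> \<le> (1 - \<rho>) c\<close>.
\<close>

lemma norm_attaining_perturbation:
  fixes sX :: "'k::real_or_complex \<Rightarrow> 'a::banach \<Rightarrow> 'a"
    and sY :: "'k \<Rightarrow> 'b::banach \<Rightarrow> 'b"
  assumes "banach_over sX" and "banach_over sY"
    and beta: "property_beta_family sY \<rho> I y ys" and i: "i \<in> I"
    and T: "T \<in> bounded_operators sX sY" "norm T \<le> 1"
    and g: "g \<in> dual_space sX" "norm g \<le> 1"
    and x: "norm x = 1" "norm (blinfun_apply g x) = 1"
    and near: "norm (g - (ys i o\<^sub>L T)) \<le> \<delta>"
    and c: "c \<ge> 0" "\<rho> * \<delta> \<le> (1 - \<rho>) * c"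
  obtains S where "S \<in> bounded_operators sX sY" "norm S = 1" "norm (blinfun_apply S x) = 1"
    "norm (S - T) \<le> \<delta> + 2 * c"
proof -
  interpret X: banach_over sX by fact
  interpret Y: banach_over sY by fact
  note op_iff = bounded_operators_iff[OF X.vector_space_axioms Y.vector_space_axioms]
  note dual_iff = dual_space_iff[OF X.vector_space_axioms]
  from beta have \<rho>: "0 \<le> \<rho>" "\<rho> < 1"
    and y: "norm (y i) = 1" "blinfun_apply (ys i) (y i) = 1"
    and ys: "\<And>k. k \<in> I \<Longrightarrow> ys k \<in> dual_space sY" "\<And>k. k \<in> I \<Longrightarrow> norm (ys k) = 1"
    and off: "\<And>k. k \<in> I \<Longrightarrow> k \<noteq> i \<Longrightarrow> norm (blinfun_apply (ys k) (y i)) \<le> \<rho>"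
    and sup: "\<And>v. ennreal (norm v) = (SUP k\<in>I. ennreal (norm (blinfun_apply (ys k) v)))"
    using i unfolding property_beta_family_def by auto
  have ys_scale: "blinfun_apply (ys k) (sY a v) = a * blinfun_apply (ys k) v" if "k \<in> I" for k a v
    using ys(1)[OF that] dual_space_iff[OF Y.vector_space_axioms] by blast
  have ys_le: "norm (blinfun_apply (ys k) v) \<le> norm v" if "k \<in> I" for k v
    using norm_blinfun[of "ys k" v] ys(2)[OF that] by simp
  have T_scale: "blinfun_apply T (sX a h) = sY a (blinfun_apply T h)" for a h
    using T(1) op_iff by blast
  have g_scale: "blinfun_apply g (sX a h) = a * blinfun_apply g h" for a h
    using g(1) dual_iff by blast
  have g_le: "norm (blinfun_apply g h) \<le> norm h" for h
    using norm_blinfun[of g h] mult_right_mono[OF g(2), of "norm h"] by simp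
  have T_le: "norm (blinfun_apply T h) \<le> norm h" for h
    using norm_blinfun[of T h] mult_right_mono[OF T(2), of "norm h"] by simp
  define q where "q = (1 + c) *\<^sub>R g - (ys i o\<^sub>L T)"
  have "q = (g - (ys i o\<^sub>L T)) + c *\<^sub>R g" by (simp add: q_def algebra_simps)
  then have "norm q \<le> norm (g - (ys i o\<^sub>L T)) + c * norm g"
    using norm_triangle_ineq[of "g - (ys i o\<^sub>L T)" "c *\<^sub>R g"] c(1) by simp
  then have norm_q: "norm q \<le> \<delta> + c"
    using near mult_left_mono[OF g(2) c(1)] by simp
  have q_le: "norm (blinfun_apply q h) \<le> (\<delta> + c) * norm h" for h
    using norm_blinfun[of q h] mult_right_mono[OF norm_q, of "norm h"] by simp
  have q_scale: "blinfun_apply q (sX a h) = a * blinfun_apply q h" for a h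
    using ys_scale[OF i]
    by (simp add: q_def blinfun.diff_left blinfun.scaleR_left g_scale T_scale right_diff_distrib)
  have "bounded_linear (\<lambda>h. sY (blinfun_apply q h) (y i))"
  proof (rule bounded_linear_intro[where K = "norm q"])
    fix a b :: 'a and r :: real
    show "sY (blinfun_apply q (a + b)) (y i) = sY (blinfun_apply q a) (y i) + sY (blinfun_apply q b) (y i)"
      by (simp add: blinfun.add_right Y.scale_left_distrib)
    show "sY (blinfun_apply q (r *\<^sub>R a)) (y i) = r *\<^sub>R sY (blinfun_apply q a) (y i)"
      by (simp add: blinfun.scaleR_right scaleR_conv_of_real flip: Y.scale_of_real Y.scale_scale)
    show "norm (sY (blinfun_apply q a) (y i)) \<le> norm a * norm q"
      using norm_blinfun[of q a] by (simp add: Y.norm_scale y mult.commute)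
  qed
  define P where "P = Blinfun (\<lambda>h. sY (blinfun_apply q h) (y i))"
  have P: "blinfun_apply P h = sY (blinfun_apply q h) (y i)" for h
    by (simp add: P_def bounded_linear_Blinfun_apply \<open>bounded_linear _\<close>)
  have norm_P: "norm P \<le> \<delta> + c"
  proof (rule order_trans[OF norm_blinfun_bound norm_q])
    show "norm (blinfun_apply P h) \<le> norm q * norm h" for h
      using norm_blinfun[of q h] by (simp add: P Y.norm_scale y)
  qed simp
  define R where "R = T + P"
  have R_i: "blinfun_apply (ys i) (blinfun_apply R h) = (1 + c) *\<^sub>R blinfun_apply g h" for h
    using ys_scale[OF i] y
    by (simp add: R_def P blinfun.add_left blinfun.add_right q_def blinfun.diff_left blinfun.scaleR_left)
  have R_le: "norm (blinfun_apply R h) \<le> (1 + c) * norm h" for h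
  proof -
    have "norm (blinfun_apply (ys k) (blinfun_apply R h)) \<le> (1 + c) * norm h" if k: "k \<in> I" for k
    proof (cases "k = i")
      case True
      then show ?thesis using R_i[of h] mult_left_mono[OF g_le[of h], of "1 + c"] c(1) by simp
    next
      case False
      have "blinfun_apply (ys k) (blinfun_apply R h)
          = blinfun_apply (ys k) (blinfun_apply T h) + blinfun_apply q h * blinfun_apply (ys k) (y i)"
        using ys_scale[OF k] by (simp add: R_def P blinfun.add_left blinfun.add_right)
      also have "norm \<dots> \<le> norm (blinfun_apply (ys k) (blinfun_apply T h))
          + norm (blinfun_apply q h) * norm (blinfun_apply (ys k) (y i))"
        using norm_triangle_ineq by (metis norm_mult)
      also have "\<dots> \<le> norm h + ((\<delta> + c) * norm h) * \<rho>"
        using order_trans[OF ys_le[OF k] T_le] order_trans[OF norm_ge_zero q_le]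
        by (intro add_mono mult_mono q_le off[OF k False]) auto
      also have "\<dots> = (1 + \<rho> * \<delta> + \<rho> * c) * norm h" by (simp add: algebra_simps)
      also have "\<dots> \<le> (1 + c) * norm h"
        using c(2) by (intro mult_right_mono) (auto simp: algebra_simps)
      finally show ?thesis .
    qed
    then have "ennreal (norm (blinfun_apply R h)) \<le> ennreal ((1 + c) * norm h)"
      unfolding sup[of "blinfun_apply R h"] by (intro SUP_least ennreal_leI)
    then show ?thesis using c(1) by simp
  qed
  have R_x: "1 + c \<le> norm (blinfun_apply R x)"
    using ys_le[OF i, of "blinfun_apply R x"] R_i[of x] x(2) c(1) by simp
  define S where "S = R /\<^sub>R (1 + c)"
  have S: "blinfun_apply S h = blinfun_apply R h /\<^sub>R (1 + c)" for h
    by (simp add: S_def blinfun.scaleR_left)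
  have "norm (blinfun_apply R x) = 1 + c" using R_x R_le[of x] x(1) by simp
  then have S_x: "norm (blinfun_apply S x) = 1" using c(1) by (simp add: S)
  have "norm S \<le> 1"
  proof (rule norm_blinfun_bound)
    show "norm (blinfun_apply S h) \<le> 1 * norm h" for h
      using R_le[of h] c(1) by (simp add: S field_simps)
  qed simp
  moreover have "1 \<le> norm S" using norm_blinfun[of S x] S_x x(1) by simp
  ultimately have norm_S: "norm S = 1" by simp
  have "sY a (r *\<^sub>R v) = r *\<^sub>R sY a v" for a r v
    by (metis Y.scale_left_commute Y.scale_of_real)
  then have "S \<in> bounded_operators sX sY"
    by (simp add: op_iff S R_def P blinfun.add_left T_scale q_scale Y.scale_right_distrib scaleR_add_right)
  moreover have "norm (S - T) \<le> \<delta> + 2 * c"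
  proof -
    have "R = (1 + c) *\<^sub>R S" using c(1) by (simp add: S_def)
    then have "S - T = P - c *\<^sub>R S" by (simp add: R_def algebra_simps)
    then show ?thesis
      using norm_triangle_ineq4[of P "c *\<^sub>R S"] norm_P norm_S c(1) by simp
  qed
  ultimately show ?thesis using that norm_S S_x by blast
qed

theorem proposition2p4:
  fixes sX :: "'k::real_or_complex \<Rightarrow> 'a::banach \<Rightarrow> 'a"
    and sY :: "'k \<Rightarrow> 'b::banach \<Rightarrow> 'b"
  assumes "banach_over sX" and "banach_over sY"
    and "uniformly_smooth TYPE('a)"
    and "property_beta sY"
  shows "BPBpp sX sY"
  unfolding BPBpp_def
proof (intro allI impI)
  fix \<epsilon> :: real assume "\<epsilon> > 0"
  interpret X: banach_over sX by fact
  interpret Y: banach_over sY by fact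
  obtain \<rho> and I :: "'b set" and y ys where beta: "property_beta_family sY \<rho> I y ys"
    using assms(4) unfolding property_beta_def by blast
  then have \<rho>: "0 \<le> \<rho>" "\<rho> < 1"
    and ys: "\<And>k. k \<in> I \<Longrightarrow> ys k \<in> dual_space sY" "\<And>k. k \<in> I \<Longrightarrow> norm (ys k) = 1"
    and sup: "\<And>v. ennreal (norm v) = (SUP k\<in>I. ennreal (norm (blinfun_apply (ys k) v)))"
    unfolding property_beta_family_def by auto
  \<comment> \<open>The smallest admissible increase \<open>c\<close> of the norm is \<open>\<rho> \<delta> / (1 - \<rho>)\<close>, so that \<open>T\<close> is moved by at
    most \<open>\<delta> + 2 c = \<delta> (1 + \<rho>) / (1 - \<rho>)\<close>; this choice of \<open>\<delta>\<close> makes that \<open>\<epsilon> (1 + \<rho>) / 3\<close>.\<close>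
  define \<delta> where "\<delta> = \<epsilon> * (1 - \<rho>) / 3"
  have "\<delta> > 0" using \<open>\<epsilon> > 0\<close> \<rho> by (simp add: \<delta>_def)
  obtain \<eta> where "\<eta> > 0" and approx: "\<And>f x. f \<in> dual_space sX \<Longrightarrow> norm f \<le> 1 \<Longrightarrow> norm x = 1 \<Longrightarrow>
      norm (blinfun_apply f x) > 1 - \<eta> \<Longrightarrow>
      \<exists>g\<in>dual_space sX. norm g \<le> 1 \<and> norm (blinfun_apply g x) = 1 \<and> norm (g - f) \<le> \<delta>"
    by (rule nearly_norming_functional_approximation[OF assms(1,3) \<open>\<delta> > 0\<close>]) blast
  \<comment> \<open>Capping \<open>\<eta>\<close> at 1 keeps \<open>1 - \<eta>\<close> nonnegative, so that the strict inequality survives the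
    passage to \<open>[0, \<infinity>]\<close> and provides an index \<open>i\<close> for which the value exceeds \<open>1 - \<eta>\<close>.\<close>
  have "\<exists>S\<in>bounded_operators sX sY. norm S = 1 \<and> norm (blinfun_apply S x) = 1 \<and> norm (S - T) < \<epsilon>"
    if T: "T \<in> bounded_operators sX sY" "norm T = 1" and x: "norm x = 1"
      and Tx: "norm (blinfun_apply T x) > 1 - min \<eta> 1" for T x
  proof -
    have "ennreal (1 - min \<eta> 1) < ennreal (norm (blinfun_apply T x))"
      using Tx by (simp add: ennreal_less_iff)
    then obtain i where i: "i \<in> I"
      and "ennreal (1 - min \<eta> 1) < ennreal (norm (blinfun_apply (ys i) (blinfun_apply T x)))"
      unfolding sup[of "blinfun_apply T x"] less_SUP_iff by blast
    then have fx: "norm (blinfun_apply (ys i o\<^sub>L T) x) > 1 - \<eta>"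
      by (simp add: ennreal_less_iff)
    have "blinfun_apply T (sX a h) = sY a (blinfun_apply T h)" for a h
      using T(1) bounded_operators_iff[OF X.vector_space_axioms Y.vector_space_axioms] by blast
    moreover have "blinfun_apply (ys i) (sY a v) = a * blinfun_apply (ys i) v" for a v
      using ys(1)[OF i] dual_space_iff[OF Y.vector_space_axioms] by blast
    ultimately have f: "(ys i o\<^sub>L T) \<in> dual_space sX"
      by (simp add: dual_space_iff[OF X.vector_space_axioms])
    have "norm (ys i o\<^sub>L T) \<le> 1"
      using norm_blinfun_compose[of "ys i" T] ys(2)[OF i] T(2) by simp
    from approx[OF f this x fx] obtain g where
      g: "g \<in> dual_space sX" "norm g \<le> 1" "norm (blinfun_apply g x) = 1" "norm (g - (ys i o\<^sub>L T)) \<le> \<delta>"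
      by blast
    define c where "c = \<epsilon> * \<rho> / 3"
    have c: "c \<ge> 0" "\<rho> * \<delta> \<le> (1 - \<rho>) * c"
      using \<open>\<epsilon> > 0\<close> \<rho> by (simp_all add: c_def \<delta>_def)
    obtain S where S: "S \<in> bounded_operators sX sY" "norm S = 1" "norm (blinfun_apply S x) = 1"
      "norm (S - T) \<le> \<delta> + 2 * c"
      by (rule norm_attaining_perturbation[OF assms(1,2) beta i T(1) _ g(1,2) x g(3,4) c])
        (use T(2) in simp)
    have "\<delta> + 2 * c = \<epsilon> * ((1 + \<rho>) / 3)" by (simp add: \<delta>_def c_def field_simps)
    also have "\<dots> < \<epsilon> * 1" using \<open>\<epsilon> > 0\<close> \<rho> by (intro mult_strict_left_mono) auto
    finally show ?thesis using S by auto
  qed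
  then show "\<exists>\<eta>>0. \<forall>T\<in>bounded_operators sX sY. \<forall>x.
       norm T = 1 \<longrightarrow> norm x = 1 \<longrightarrow> norm (blinfun_apply T x) > 1 - \<eta> \<longrightarrow>
       (\<exists>S\<in>bounded_operators sX sY.
          norm S = 1 \<and> norm (blinfun_apply S x) = 1 \<and> norm (S - T) < \<epsilon>)"
    using \<open>\<eta> > 0\<close> by (intro exI[of _ "min \<eta> 1"]) auto
qed

end
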